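(* The operator $$\mathcal{A}_\varphi: L^2(\mathbb{R})/S^1 \to L^2(\mathbb{R}^2,\mathbb{R}_0^+),\qquad f\mapsto |V_\varphi f|,$$ is not compact.
   Context: Let $\varphi(t)=e^{-\pi t^2}$. The Gabor transform of $f\in L^2(\mathbb{R})$ (complex-valued) is $V_\varphi f(x,y)=\int_{\mathbb{R}} f(t)\varphi(t-x)e^{-2\pi i t y}\,dt$, and $|V_\varphi f|(x,y)=|V_\varphi f(x,y)|$ for $(x,y)\in\mathbb{R}^2$. $S^1=\{z\in\mathbb{C}: |z|=1\}$, and $L^2(\mathbb{R})/S^1$ is the quotient identifying $f$ with $\tau f$ for $\tau\in S^1$, with metric $\mathrm{dist}(f,g)=\inf_{\tau\in S^1}\|f-\tau g\|_{L^2(\mathbb{R})}$; $\|f\|_{L^2(\mathbb{R})}$ is well defined on classes. $L^2(\mathbb{R}^2,\mathbb{R}_0^+)$ is the set of nonnegative functions in $L^2(\mathbb{R}^2)$ with the $L^2$-metric. A (nonlinear) operator is compact if it maps bounded sets to relatively compact sets. *)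

theory Defs
  imports "HOL-Analysis.Analysis"
begin

section \<open>Square-integrable functions\<close>

definition square_integrable ::
  "'a measure \<Rightarrow> ('a \<Rightarrow> 'b::{banach, second_countable_topology}) set" where
  "square_integrable M =
     {f. f \<in> borel_measurable M \<and> integrable M (\<lambda>x. (norm (f x))\<^sup>2)}"

definition L2_norm ::
  "'a measure \<Rightarrow> ('a \<Rightarrow> 'b::{banach, second_countable_topology}) \<Rightarrow> real" where
  "L2_norm M f = sqrt (LINT x|M. (norm (f x))\<^sup>2)"

lemma L2_norm_nonneg: "0 \<le> L2_norm M f"
  by (simp add: L2_norm_def)

lemma L2_norm_power2: "(L2_norm M f)\<^sup>2 = (LINT x|M. (norm (f x))\<^sup>2)"
  by (simp add: L2_norm_def)

lemma L2_norm_minus_commute: "L2_norm M (\<lambda>x. f x - g x) = L2_norm M (\<lambda>x. g x - f x)"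
  by (simp add: L2_norm_def norm_minus_commute)

lemma L2_norm_cong_AE:
  assumes "f \<in> borel_measurable M" "g \<in> borel_measurable M" "AE x in M. norm (f x) = norm (g x)"
  shows "L2_norm M f = L2_norm M g"
  unfolding L2_norm_def
  by (rule arg_cong[where f = sqrt], rule integral_cong_AE) (use assms in auto)

lemma L2_norm_scale:
  fixes f :: "'a \<Rightarrow> complex"
  shows "L2_norm M (\<lambda>x. c * f x) = norm c * L2_norm M f"
  by (simp add: L2_norm_def norm_mult power_mult_distrib real_sqrt_mult)

lemma L2_norm_eq_0_iff:
  assumes "f \<in> square_integrable M"
  shows "L2_norm M f = 0 \<longleftrightarrow> (AE x in M. f x = 0)"
proof -
  have "L2_norm M f = 0 \<longleftrightarrow> (LINT x|M. (norm (f x))\<^sup>2) = 0"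
    by (simp add: L2_norm_def)
  also have "\<dots> \<longleftrightarrow> (AE x in M. (norm (f x))\<^sup>2 = 0)"
    by (rule integral_nonneg_eq_0_iff_AE) (use assms in \<open>auto simp: square_integrable_def\<close>)
  finally show ?thesis by simp
qed

lemma square_integrable_measurable:
  "f \<in> square_integrable M \<Longrightarrow> f \<in> borel_measurable M"
  by (simp add: square_integrable_def)

lemma square_integrable_add:
  assumes "f \<in> square_integrable M" "g \<in> square_integrable M"
  shows "(\<lambda>x. f x + g x) \<in> square_integrable M"
proof -
  have [measurable]: "f \<in> borel_measurable M" "g \<in> borel_measurable M"
    using assms by (auto simp: square_integrable_def)
  have int: "integrable M (\<lambda>x. 2 * (norm (f x))\<^sup>2 + 2 * (norm (g x))\<^sup>2)"
    using assms by (auto simp: square_integrable_def)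
  have "(norm (f x + g x))\<^sup>2 \<le> 2 * (norm (f x))\<^sup>2 + 2 * (norm (g x))\<^sup>2" for x
  proof -
    have "(norm (f x + g x))\<^sup>2 \<le> (norm (f x) + norm (g x))\<^sup>2"
      by (intro power_mono norm_triangle_ineq) auto
    also have "\<dots> \<le> 2 * (norm (f x))\<^sup>2 + 2 * (norm (g x))\<^sup>2"
      using sum_squares_bound[of "norm (f x)" "norm (g x)"] by (simp add: power2_sum)
    finally show ?thesis .
  qed
  then have "integrable M (\<lambda>x. (norm (f x + g x))\<^sup>2)"
    by (intro Bochner_Integration.integrable_bound[OF int]) auto
  then show ?thesis by (simp add: square_integrable_def)
qed

lemma square_integrable_scale:
  fixes f :: "'a \<Rightarrow> complex"
  assumes "f \<in> square_integrable M"
  shows "(\<lambda>x. c * f x) \<in> square_integrable M"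
  using assms by (auto simp: square_integrable_def norm_mult power_mult_distrib)

lemma square_integrable_diff:
  assumes "f \<in> square_integrable M" "g \<in> square_integrable M"
  shows "(\<lambda>x. f x - g x) \<in> square_integrable M"
proof -
  have "(\<lambda>x. - g x) \<in> square_integrable M"
    using assms(2) by (auto simp: square_integrable_def)
  from square_integrable_add[OF assms(1) this] show ?thesis by simp
qed

lemma L2_norm_triangle:
  assumes "f \<in> square_integrable M" "g \<in> square_integrable M"
  shows "L2_norm M (\<lambda>x. f x + g x) \<le> L2_norm M f + L2_norm M g"
proof (rule field_le_epsilon)
  fix e :: real assume "0 < e"
  define p where "p = L2_norm M f + e / 2"
  define q where "q = L2_norm M g + e / 2"
  have pq: "p > 0" "q > 0"
    using \<open>0 < e\<close> L2_norm_nonneg[of M f] L2_norm_nonneg[of M g] by (auto simp: p_def q_def)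
  have pw: "(norm (f x + g x))\<^sup>2 \<le> (p + q) * ((norm (f x))\<^sup>2 / p + (norm (g x))\<^sup>2 / q)" for x
  proof -
    define a where "a = norm (f x)"
    define b where "b = norm (g x)"
    have "(norm (f x + g x))\<^sup>2 \<le> (a + b)\<^sup>2"
      unfolding a_def b_def by (intro power_mono norm_triangle_ineq) auto
    also have "\<dots> \<le> (p + q) * (a\<^sup>2 / p + b\<^sup>2 / q)"
    proof -
      have "(p + q) * (a\<^sup>2 / p + b\<^sup>2 / q) - (a + b)\<^sup>2 = (q * a - p * b)\<^sup>2 / (p * q)"
        using pq by (simp add: field_simps power2_eq_square)
      moreover have "\<dots> \<ge> 0" using pq by simp
      ultimately show ?thesis by linarith
    qed
    finally show ?thesis by (simp add: a_def b_def)
  qed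
  have intf: "integrable M (\<lambda>x. (norm (f x))\<^sup>2)" and intg: "integrable M (\<lambda>x. (norm (g x))\<^sup>2)"
    and intfg: "integrable M (\<lambda>x. (norm (f x + g x))\<^sup>2)"
    using assms square_integrable_add[OF assms] by (auto simp: square_integrable_def)
  have "(L2_norm M (\<lambda>x. f x + g x))\<^sup>2
      \<le> (LINT x|M. (p + q) * ((norm (f x))\<^sup>2 / p + (norm (g x))\<^sup>2 / q))"
    unfolding L2_norm_power2 by (rule integral_mono) (use intf intg intfg pw in auto)
  also have "\<dots> = (p + q) * ((L2_norm M f)\<^sup>2 / p + (L2_norm M g)\<^sup>2 / q)"
    unfolding L2_norm_power2 using intf intg by simp
  also have "\<dots> \<le> (p + q) * (p\<^sup>2 / p + q\<^sup>2 / q)"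
    using pq \<open>0 < e\<close> L2_norm_nonneg[of M f] L2_norm_nonneg[of M g]
    by (intro mult_left_mono add_mono divide_right_mono power_mono) (auto simp: p_def q_def)
  also have "\<dots> = (p + q)\<^sup>2" using pq by (simp add: power2_eq_square)
  finally have "L2_norm M (\<lambda>x. f x + g x) \<le> p + q"
    by (rule power2_le_imp_le) (use pq in simp)
  then show "L2_norm M (\<lambda>x. f x + g x) \<le> L2_norm M f + L2_norm M g + e"
    by (simp add: p_def q_def)
qed

lemma L2_norm_triangle_diff:
  assumes "f \<in> square_integrable M" "g \<in> square_integrable M" "h \<in> square_integrable M"
  shows "L2_norm M (\<lambda>x. f x - h x) \<le> L2_norm M (\<lambda>x. f x - g x) + L2_norm M (\<lambda>x. g x - h x)"
  using L2_norm_triangle[OF square_integrable_diff[OF assms(1,2)] square_integrable_diff[OF assms(2,3)]]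
  by simp


section \<open>Quotients\<close>

definition ae_rel ::
  "'a measure \<Rightarrow> (('a \<Rightarrow> 'b::{banach, second_countable_topology}) \<times> ('a \<Rightarrow> 'b)) set" where
  "ae_rel M = {(f, g). f \<in> square_integrable M \<and> g \<in> square_integrable M \<and>
                       (AE x in M. f x = g x)}"

text \<open>Equality almost everywhere up to a unimodular factor: the passage from functions to
  \<open>L\<^sup>2\<close> and from \<open>L\<^sup>2\<close> to \<open>L\<^sup>2 / S\<^sup>1\<close> is made in one step.\<close>

definition phase_rel :: "'a measure \<Rightarrow> (('a \<Rightarrow> complex) \<times> ('a \<Rightarrow> complex)) set" where
  "phase_rel M = {(f, g). f \<in> square_integrable M \<and> g \<in> square_integrable M \<and>
                          (\<exists>\<tau>\<in>sphere 0 1. AE x in M. f x = \<tau> * g x)}"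

lemma equiv_ae_rel: "equiv (square_integrable M) (ae_rel M)"
proof (rule equivI)
  show "ae_rel M \<subseteq> square_integrable M \<times> square_integrable M"
    by (auto simp: ae_rel_def)
  show "refl_on (square_integrable M) (ae_rel M)"
    by (auto simp: refl_on_def ae_rel_def)
  show "sym (ae_rel M)"
    by (auto simp: sym_def ae_rel_def eq_commute)
  show "trans (ae_rel M)"
    unfolding trans_def ae_rel_def by auto
qed

lemma equiv_phase_rel: "equiv (square_integrable M) (phase_rel M)"
proof (rule equivI)
  show "phase_rel M \<subseteq> square_integrable M \<times> square_integrable M"
    by (auto simp: phase_rel_def)
  show "refl_on (square_integrable M) (phase_rel M)"
    by (auto simp: refl_on_def phase_rel_def intro!: bexI[of _ 1])
  show "sym (phase_rel M)"
  proof (rule symI)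
    fix f g assume "(f, g) \<in> phase_rel M"
    then obtain \<tau> where *: "f \<in> square_integrable M" "g \<in> square_integrable M"
      "norm \<tau> = 1" "AE x in M. f x = \<tau> * g x"
      by (auto simp: phase_rel_def)
    have "\<tau> \<noteq> 0" using *(3) by auto
    with *(4) have "AE x in M. g x = inverse \<tau> * f x"
      by (auto simp: field_simps)
    with * show "(g, f) \<in> phase_rel M"
      by (auto simp: phase_rel_def norm_inverse intro!: bexI[of _ "inverse \<tau>"])
  qed
  show "trans (phase_rel M)"
  proof (rule transI)
    fix f g h assume "(f, g) \<in> phase_rel M" "(g, h) \<in> phase_rel M"
    then obtain \<tau> \<sigma> where *: "f \<in> square_integrable M" "h \<in> square_integrable M"
      "norm \<tau> = 1" "AE x in M. f x = \<tau> * g x" "norm \<sigma> = 1" "AE x in M. g x = \<sigma> * h x"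
      by (auto simp: phase_rel_def)
    from *(4,6) have "AE x in M. f x = (\<tau> * \<sigma>) * h x" by auto
    with * show "(f, h) \<in> phase_rel M"
      by (auto simp: phase_rel_def norm_mult intro!: bexI[of _ "\<tau> * \<sigma>"])
  qed
qed

definition rep :: "'a set \<Rightarrow> 'a" where
  "rep F = (SOME f. f \<in> F)"

lemma rep_class:
  assumes "equiv A r" "f \<in> A"
  shows "(f, rep (r `` {f})) \<in> r"
proof -
  have "f \<in> r `` {f}" by (rule equiv_class_self[OF assms])
  then have "rep (r `` {f}) \<in> r `` {f}" unfolding rep_def by (rule someI)
  then show ?thesis by simp
qed

lemma class_rep:
  assumes "equiv A r" "F \<in> A // r"
  shows "rep F \<in> A" and "r `` {rep F} = F"
proof -
  from assms(2) obtain f where f: "f \<in> A" "F = r `` {f}" by (rule quotientE)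
  have "(f, rep F) \<in> r" unfolding f(2) by (rule rep_class[OF assms(1) f(1)])
  then show "r `` {rep F} = F"
    using equiv_class_eq[OF assms(1)] f(2) by metis
  have "r \<subseteq> A \<times> A" using assms(1) by (rule equiv_type)
  with \<open>(f, rep F) \<in> r\<close> show "rep F \<in> A" by blast
qed


section \<open>The metric space of nonnegative functions in \<open>L\<^sup>2(\<real>\<^sup>2)\<close>\<close>

text \<open>Borel rather than Lebesgue measurable representatives are used throughout; as every
  Lebesgue measurable function agrees almost everywhere with a Borel one, the spaces of classes
  are the same.\<close>

definition L2_dist :: "('a::euclidean_space \<Rightarrow> 'b::{banach, second_countable_topology}) set \<Rightarrow>
    ('a \<Rightarrow> 'b) set \<Rightarrow> real" where
  "L2_dist F G = L2_norm lborel (\<lambda>z. rep F z - rep G z)"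

lemma L2_dist_class:
  assumes "f \<in> square_integrable lborel" "g \<in> square_integrable lborel"
  shows "L2_dist (ae_rel lborel `` {f}) (ae_rel lborel `` {g}) = L2_norm lborel (\<lambda>z. f z - g z)"
proof -
  note f = rep_class[OF equiv_ae_rel assms(1)] and g = rep_class[OF equiv_ae_rel assms(2)]
  have [measurable]: "f \<in> borel_measurable lborel" "g \<in> borel_measurable lborel"
    "rep (ae_rel lborel `` {f}) \<in> borel_measurable lborel"
    "rep (ae_rel lborel `` {g}) \<in> borel_measurable lborel"
    using f g by (auto simp: ae_rel_def square_integrable_def)
  have "AE z in lborel. f z = rep (ae_rel lborel `` {f}) z"
       "AE z in lborel. g z = rep (ae_rel lborel `` {g}) z"
    using f g by (auto simp: ae_rel_def)
  then have "AE z in lborel. norm (rep (ae_rel lborel `` {f}) z - rep (ae_rel lborel `` {g}) z)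
      = norm (f z - g z)"
    by eventually_elim simp
  then show ?thesis
    unfolding L2_dist_def by (intro L2_norm_cong_AE) auto
qed

lemma Metric_space_L2: "Metric_space (square_integrable lborel // ae_rel lborel) L2_dist"
proof
  fix F G H :: "('a \<Rightarrow> 'b) set"
  show "0 \<le> L2_dist F G" by (simp add: L2_dist_def L2_norm_nonneg)
  show "L2_dist F G = L2_dist G F" unfolding L2_dist_def by (rule L2_norm_minus_commute)
  assume F: "F \<in> square_integrable lborel // ae_rel lborel"
    and G: "G \<in> square_integrable lborel // ae_rel lborel"
  note f = class_rep[OF equiv_ae_rel F] and g = class_rep[OF equiv_ae_rel G]
  show "L2_dist F G = 0 \<longleftrightarrow> F = G"
  proof
    assume "L2_dist F G = 0"
    then have "AE z in lborel. rep F z - rep G z = 0"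
      using L2_norm_eq_0_iff[OF square_integrable_diff[OF f(1) g(1)]] by (simp add: L2_dist_def)
    then have "(rep F, rep G) \<in> ae_rel lborel"
      using f(1) g(1) by (auto simp: ae_rel_def)
    then have "ae_rel lborel `` {rep F} = ae_rel lborel `` {rep G}"
      by (rule equiv_class_eq[OF equiv_ae_rel])
    then show "F = G" using f(2) g(2) by simp
  qed (simp add: L2_dist_def L2_norm_def)
  assume H: "H \<in> square_integrable lborel // ae_rel lborel"
  show "L2_dist F H \<le> L2_dist F G + L2_dist G H"
    unfolding L2_dist_def
    by (rule L2_norm_triangle_diff[OF f(1) g(1) class_rep(1)[OF equiv_ae_rel H]])
qed

text \<open>The carrier consists of the classes in \<open>L\<^sup>2(\<real>\<^sup>2)\<close> that contain a nonnegative function.\<close>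

definition L2_nonneg :: "(real \<times> real \<Rightarrow> real) set metric" where
  "L2_nonneg = metric ({f \<in> square_integrable lborel. \<forall>z. 0 \<le> f z} // ae_rel lborel, L2_dist)"

lemma Metric_space_L2_nonneg:
  "Metric_space ({f \<in> square_integrable lborel. \<forall>z. (0::real) \<le> f z} // ae_rel lborel) L2_dist"
proof -
  have "{f \<in> square_integrable lborel. \<forall>z. (0::real) \<le> f z} // ae_rel lborel
      \<subseteq> square_integrable lborel // ae_rel lborel"
    unfolding quotient_def by (rule UN_mono) auto
  then show ?thesis
    by (rule Metric_space.subspace[OF Metric_space_L2])
qed

lemma mspace_L2_nonneg:
  "mspace L2_nonneg = {f \<in> square_integrable lborel. \<forall>z. 0 \<le> f z} // ae_rel lborel"
  unfolding L2_nonneg_def by (rule Metric_space.mspace_metric[OF Metric_space_L2_nonneg])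

lemma mdist_L2_nonneg: "mdist L2_nonneg = L2_dist"
  unfolding L2_nonneg_def by (rule Metric_space.mdist_metric[OF Metric_space_L2_nonneg])


section \<open>The metric space \<open>L\<^sup>2(\<real>) / S\<^sup>1\<close>\<close>

definition phase_dist :: "(real \<Rightarrow> complex) set \<Rightarrow> (real \<Rightarrow> complex) set \<Rightarrow> real" where
  "phase_dist F G = (INF \<tau>\<in>sphere 0 1. L2_norm lborel (\<lambda>t. rep F t - \<tau> * rep G t))"

definition L2_mod_phase :: "(real \<Rightarrow> complex) set metric" where
  "L2_mod_phase = metric (square_integrable lborel // phase_rel lborel, phase_dist)"

lemma bdd_below_L2_norm: "bdd_below ((\<lambda>\<tau>. L2_norm M (h \<tau>)) ` S)"
  by (rule bdd_belowI2[where m = 0]) (rule L2_norm_nonneg)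

lemma phase_INF_le:
  fixes f g :: "'a \<Rightarrow> complex"
  assumes "f \<in> borel_measurable M" "g \<in> borel_measurable M"
    "f' \<in> borel_measurable M" "g' \<in> borel_measurable M"
    and \<sigma>: "norm \<sigma> = 1" "AE x in M. f x = \<sigma> * f' x"
    and \<rho>: "norm \<rho> = 1" "AE x in M. g x = \<rho> * g' x"
  shows "(INF \<tau>\<in>sphere 0 1. L2_norm M (\<lambda>x. f' x - \<tau> * g' x))
       \<le> (INF \<tau>\<in>sphere 0 1. L2_norm M (\<lambda>x. f x - \<tau> * g x))"
proof (rule cINF_mono)
  show "sphere 0 1 \<noteq> ({} :: complex set)" by simp
  show "bdd_below ((\<lambda>\<tau>. L2_norm M (\<lambda>x. f' x - \<tau> * g' x)) ` sphere 0 1)"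
    by (rule bdd_below_L2_norm)
  fix \<tau> :: complex assume \<tau>: "\<tau> \<in> sphere 0 1"
  note [measurable] = assms(1-4)
  have "\<sigma> \<noteq> 0" using \<sigma> by auto
  have "AE x in M. norm (f' x - (\<tau> * \<rho> / \<sigma>) * g' x) = norm (f x - \<tau> * g x)"
    using \<sigma>(2) \<rho>(2)
  proof eventually_elim
    case (elim x)
    have "f x - \<tau> * g x = \<sigma> * (f' x - (\<tau> * \<rho> / \<sigma>) * g' x)"
      using elim \<open>\<sigma> \<noteq> 0\<close> by (simp add: field_simps)
    then show ?case using \<sigma>(1) by (simp add: norm_mult)
  qed
  then have "L2_norm M (\<lambda>x. f' x - (\<tau> * \<rho> / \<sigma>) * g' x) = L2_norm M (\<lambda>x. f x - \<tau> * g x)"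
    by (intro L2_norm_cong_AE) auto
  moreover have "\<tau> * \<rho> / \<sigma> \<in> sphere 0 1"
    using \<tau> \<sigma>(1) \<rho>(1) by (simp add: norm_mult norm_divide)
  ultimately show "\<exists>n\<in>sphere 0 1. L2_norm M (\<lambda>x. f' x - n * g' x) \<le> L2_norm M (\<lambda>x. f x - \<tau> * g x)"
    by (intro bexI[of _ "\<tau> * \<rho> / \<sigma>"]) auto
qed

lemma phase_dist_class:
  assumes "f \<in> square_integrable lborel" "g \<in> square_integrable lborel"
  shows "phase_dist (phase_rel lborel `` {f}) (phase_rel lborel `` {g})
       = (INF \<tau>\<in>sphere 0 1. L2_norm lborel (\<lambda>t. f t - \<tau> * g t))"
proof -
  note f = rep_class[OF equiv_phase_rel assms(1)] and g = rep_class[OF equiv_phase_rel assms(2)]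
  have sym: "(b, a) \<in> phase_rel lborel" if "(a, b) \<in> phase_rel lborel" for a b :: "real \<Rightarrow> complex"
    using equiv_phase_rel[of "lborel :: real measure"] that by (auto simp: equiv_def dest: symD)
  have le: "(INF \<tau>\<in>sphere 0 1. L2_norm lborel (\<lambda>t. f' t - \<tau> * g' t))
      \<le> (INF \<tau>\<in>sphere 0 1. L2_norm lborel (\<lambda>t. f t - \<tau> * g t))"
    if fg: "(f, f') \<in> phase_rel lborel" "(g, g') \<in> phase_rel lborel" for f f' g g' :: "real \<Rightarrow> complex"
  proof -
    obtain \<sigma> \<rho> where "norm \<sigma> = 1" "AE x in lborel. f x = \<sigma> * f' x"
      "norm \<rho> = 1" "AE x in lborel. g x = \<rho> * g' x"
      using fg by (auto simp: phase_rel_def)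
    then show ?thesis
      by (intro phase_INF_le) (use fg in \<open>auto simp: phase_rel_def square_integrable_def\<close>)
  qed
  show ?thesis
    unfolding phase_dist_def by (intro antisym le f g sym)
qed

lemma phase_dist_commute: "phase_dist F G = phase_dist G F"
proof -
  have le: "phase_dist G F \<le> phase_dist F G" for F G
    unfolding phase_dist_def
  proof (rule cINF_mono)
    show "sphere 0 1 \<noteq> ({} :: complex set)" by simp
    show "bdd_below ((\<lambda>\<tau>. L2_norm lborel (\<lambda>t. rep G t - \<tau> * rep F t)) ` sphere 0 1)"
      by (rule bdd_below_L2_norm)
    fix \<tau> :: complex assume \<tau>: "\<tau> \<in> sphere 0 1"
    then have "\<tau> \<noteq> 0" by auto
    have "norm (rep G t - inverse \<tau> * rep F t) = norm (rep F t - \<tau> * rep G t)" for t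
    proof -
      have "rep F t - \<tau> * rep G t = (- \<tau>) * (rep G t - inverse \<tau> * rep F t)"
        using \<open>\<tau> \<noteq> 0\<close> by (simp add: field_simps)
      then show ?thesis using \<tau> by (simp add: norm_mult)
    qed
    then have "L2_norm lborel (\<lambda>t. rep G t - inverse \<tau> * rep F t)
        = L2_norm lborel (\<lambda>t. rep F t - \<tau> * rep G t)"
      by (simp add: L2_norm_def)
    then show "\<exists>n\<in>sphere 0 1. L2_norm lborel (\<lambda>t. rep G t - n * rep F t)
        \<le> L2_norm lborel (\<lambda>t. rep F t - \<tau> * rep G t)"
      using \<tau> by (intro bexI[of _ "inverse \<tau>"]) (auto simp: norm_inverse)
  qed
  show ?thesis by (intro antisym le)
qed

lemma phase_dist_attained:
  assumes "F \<in> square_integrable lborel // phase_rel lborel"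
    and "G \<in> square_integrable lborel // phase_rel lborel"
  obtains \<tau> where "norm \<tau> = 1" "phase_dist F G = L2_norm lborel (\<lambda>t. rep F t - \<tau> * rep G t)"
proof -
  note f = class_rep(1)[OF equiv_phase_rel assms(1)] and g = class_rep(1)[OF equiv_phase_rel assms(2)]
  define N where "N \<tau> = L2_norm lborel (\<lambda>t. rep F t - \<tau> * rep G t)" for \<tau>
  have sq: "(\<lambda>t. rep F t - \<tau> * rep G t) \<in> square_integrable lborel" for \<tau>
    by (intro square_integrable_diff square_integrable_scale f g)
  have le: "N \<tau> \<le> N \<sigma> + L2_norm lborel (rep G) * dist \<tau> \<sigma>" for \<tau> \<sigma>
  proof -
    have "N \<tau> \<le> N \<sigma> + L2_norm lborel (\<lambda>t. (\<sigma> - \<tau>) * rep G t)"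
      using L2_norm_triangle[OF sq[of \<sigma>] square_integrable_scale[OF g, of "\<sigma> - \<tau>"]]
      by (simp add: N_def algebra_simps)
    then show ?thesis
      unfolding L2_norm_scale dist_norm by (simp only: norm_minus_commute mult.commute)
  qed
  have "(L2_norm lborel (rep G))-lipschitz_on (sphere 0 1) N"
  proof (rule lipschitz_onI)
    fix \<tau> \<sigma> show "dist (N \<tau>) (N \<sigma>) \<le> L2_norm lborel (rep G) * dist \<tau> \<sigma>"
      using le[of \<tau> \<sigma>] le[of \<sigma> \<tau>] by (auto simp: dist_real_def dist_commute)
  qed (rule L2_norm_nonneg)
  then have "continuous_on (sphere 0 1) N" by (rule lipschitz_on_continuous_on)
  moreover have "compact (sphere 0 1 :: complex set)" "sphere 0 1 \<noteq> ({} :: complex set)" by auto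
  ultimately obtain \<tau> where \<tau>: "\<tau> \<in> sphere 0 1" "\<And>\<sigma>. \<sigma> \<in> sphere 0 1 \<Longrightarrow> N \<tau> \<le> N \<sigma>"
    using continuous_attains_inf by metis
  have "phase_dist F G = N \<tau>"
    unfolding phase_dist_def N_def[symmetric]
  proof (rule antisym)
    show "(INF \<sigma>\<in>sphere 0 1. N \<sigma>) \<le> N \<tau>"
      by (rule cINF_lower[OF _ \<tau>(1)]) (simp add: N_def bdd_below_L2_norm)
    show "N \<tau> \<le> (INF \<sigma>\<in>sphere 0 1. N \<sigma>)"
      by (rule cINF_greatest) (use \<tau>(2) in auto)
  qed
  with \<tau>(1) show ?thesis by (intro that[of \<tau>]) (auto simp: N_def)
qed

lemma Metric_space_L2_mod_phase:
  "Metric_space (square_integrable lborel // phase_rel lborel) phase_dist"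
proof
  fix F G H :: "(real \<Rightarrow> complex) set"
  show "0 \<le> phase_dist F G"
    unfolding phase_dist_def by (rule cINF_greatest) (auto simp: L2_norm_nonneg)
  show "phase_dist F G = phase_dist G F" by (rule phase_dist_commute)
  assume F: "F \<in> square_integrable lborel // phase_rel lborel"
    and G: "G \<in> square_integrable lborel // phase_rel lborel"
  note f = class_rep[OF equiv_phase_rel F] and g = class_rep[OF equiv_phase_rel G]
  obtain \<tau> where \<tau>: "norm \<tau> = 1" "phase_dist F G = L2_norm lborel (\<lambda>t. rep F t - \<tau> * rep G t)"
    by (rule phase_dist_attained[OF F G])
  show "phase_dist F G = 0 \<longleftrightarrow> F = G"
  proof
    assume "phase_dist F G = 0"
    then have "AE t in lborel. rep F t - \<tau> * rep G t = 0"
      using L2_norm_eq_0_iff[OF square_integrable_diff[OF f(1) square_integrable_scale[OF g(1), of \<tau>]]]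
        \<tau>(2) by simp
    then have "(rep F, rep G) \<in> phase_rel lborel"
      using f(1) g(1) \<tau>(1) by (auto simp: phase_rel_def)
    then have "phase_rel lborel `` {rep F} = phase_rel lborel `` {rep G}"
      by (rule equiv_class_eq[OF equiv_phase_rel])
    then show "F = G" using f(2) g(2) by simp
  next
    assume "F = G"
    have "phase_dist F F \<le> L2_norm lborel (\<lambda>t. rep F t - 1 * rep F t)"
      unfolding phase_dist_def by (rule cINF_lower[OF bdd_below_L2_norm]) simp
    moreover have "0 \<le> phase_dist F F"
      unfolding phase_dist_def by (rule cINF_greatest) (auto simp: L2_norm_nonneg)
    ultimately show "phase_dist F G = 0" using \<open>F = G\<close> by (simp add: L2_norm_def)
  qed
  assume H: "H \<in> square_integrable lborel // phase_rel lborel"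
  note h = class_rep[OF equiv_phase_rel H]
  obtain \<sigma> where \<sigma>: "norm \<sigma> = 1" "phase_dist G H = L2_norm lborel (\<lambda>t. rep G t - \<sigma> * rep H t)"
    by (rule phase_dist_attained[OF G H])
  have "phase_dist F H \<le> L2_norm lborel (\<lambda>t. rep F t - (\<tau> * \<sigma>) * rep H t)"
    unfolding phase_dist_def
    by (rule cINF_lower[OF bdd_below_L2_norm]) (use \<tau>(1) \<sigma>(1) in \<open>simp add: norm_mult\<close>)
  also have "\<dots> \<le> L2_norm lborel (\<lambda>t. rep F t - \<tau> * rep G t)
      + L2_norm lborel (\<lambda>t. \<tau> * rep G t - (\<tau> * \<sigma>) * rep H t)"
    by (intro L2_norm_triangle_diff square_integrable_scale f(1) g(1) h(1))
  also have "(\<lambda>t. \<tau> * rep G t - (\<tau> * \<sigma>) * rep H t) = (\<lambda>t. \<tau> * (rep G t - \<sigma> * rep H t))"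
    by (simp add: algebra_simps)
  finally show "phase_dist F H \<le> phase_dist F G + phase_dist G H"
    using \<tau> \<sigma> by (simp add: L2_norm_scale)
qed

lemma mspace_L2_mod_phase: "mspace L2_mod_phase = square_integrable lborel // phase_rel lborel"
  unfolding L2_mod_phase_def by (rule Metric_space.mspace_metric[OF Metric_space_L2_mod_phase])

lemma mdist_L2_mod_phase: "mdist L2_mod_phase = phase_dist"
  unfolding L2_mod_phase_def by (rule Metric_space.mdist_metric[OF Metric_space_L2_mod_phase])


section \<open>The Gabor transform and its magnitude operator\<close>

definition gauss_window :: "real \<Rightarrow> real" where
  "gauss_window t = exp (- pi * t\<^sup>2)"

definition gabor :: "(real \<Rightarrow> complex) \<Rightarrow> real \<times> real \<Rightarrow> complex" where
  "gabor f = (\<lambda>(x, y). LINT t|lborel.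
     f t * of_real (gauss_window (t - x)) * exp (- 2 * of_real pi * \<i> * of_real t * of_real y))"

text \<open>Independence of the chosen representative is \<open>gabor_magnitude_class\<close> below.\<close>

definition gabor_magnitude :: "(real \<Rightarrow> complex) set \<Rightarrow> (real \<times> real \<Rightarrow> real) set" where
  "gabor_magnitude F = ae_rel lborel `` {\<lambda>z. norm (gabor (rep F) z)}"

lemma norm_gabor_cong:
  assumes "(f, g) \<in> phase_rel lborel"
  shows "norm (gabor f z) = norm (gabor g z)"
proof -
  obtain \<tau> where \<tau>: "norm \<tau> = 1" "AE t in lborel. f t = \<tau> * g t"
    and [measurable]: "f \<in> borel_measurable borel" "g \<in> borel_measurable borel"
    using assms by (auto simp: phase_rel_def square_integrable_def)
  obtain x y where z: "z = (x, y)" by (cases z)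
  have [measurable]: "gauss_window \<in> borel_measurable borel"
    unfolding gauss_window_def by measurable
  define k :: "real \<Rightarrow> complex" where
    "k t = of_real (gauss_window (t - x)) * exp (- 2 * of_real pi * \<i> * of_real t * of_real y)" for t
  have gabor_k: "gabor h z = (LINT t|lborel. h t * k t)" for h
    by (simp add: gabor_def z k_def mult.assoc)
  have [measurable]: "k \<in> borel_measurable borel"
    unfolding k_def by measurable
  have "gabor f z = (LINT t|lborel. \<tau> * (g t * k t))"
    unfolding gabor_k
  proof (rule integral_cong_AE)
    show "AE t in lborel. f t * k t = \<tau> * (g t * k t)"
      using \<tau>(2) by eventually_elim simp
  qed measurable
  also have "\<dots> = \<tau> * gabor g z"
    by (simp add: gabor_k)
  finally show ?thesis using \<tau>(1) by (simp add: norm_mult)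
qed

lemma gabor_magnitude_class:
  assumes "f \<in> square_integrable lborel"
  shows "gabor_magnitude (phase_rel lborel `` {f}) = ae_rel lborel `` {\<lambda>z. norm (gabor f z)}"
  using norm_gabor_cong[OF rep_class[OF equiv_phase_rel assms]] by (simp add: gabor_magnitude_def)


section \<open>Compact operators between metric spaces\<close>

definition relatively_compact_in :: "'a topology \<Rightarrow> 'a set \<Rightarrow> bool" where
  "relatively_compact_in X S \<longleftrightarrow> compactin X (X closure_of S)"

text \<open>\<open>A\<close> is meant to map \<open>mspace X\<close> into \<open>mspace Y\<close>. This is deliberately not part of the
  definition, so that refuting \<open>compact_operator\<close> really requires a bounded set whose image is
  not relatively compact.\<close>

definition compact_operator :: "'a metric \<Rightarrow> 'b metric \<Rightarrow> ('a \<Rightarrow> 'b) \<Rightarrow> bool" where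
  "compact_operator X Y A \<longleftrightarrow>
     (\<forall>S. Metric_space.mbounded (mspace X) (mdist X) S \<longrightarrow>
          relatively_compact_in (mtopology_of Y) (A ` S))"

end

theory Submission
  imports Defs "HOL-Probability.Characteristic_Functions"
begin

text \<open>
  Translates \<open>f\<^sub>a(t) = \<phi>(t - a)\<close> of the window all have the same norm, so \<open>f\<^sub>0, f\<^sub>1, f\<^sub>2, \<dots>\<close> form a
  bounded set in \<open>L\<^sup>2(\<real>) / S\<^sup>1\<close>. A translation in time merely translates the magnitude of the Gabor
  transform, so the bumps \<open>|V\<^sub>\<phi> f\<^sub>n|\<close> drift off to infinity without changing shape, and any two of
  them are at least a fixed positive distance apart. Hence their classes have no convergent
  subsequence.

  Everything about these bumps is explicit. The Fourier transform of a Gaussian gives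
  \<open>|V\<^sub>\<phi> f\<^sub>a|\<^sup>2(x, y) = \<phi>(x - a) \<phi>(y) / 2\<close> (\<open>norm_gabor_shifted_window\<close>). The mixed products are
  again Gaussians, because the product of two bumps centred at \<open>a\<close> and \<open>b\<close> is, up to the factor
  \<open>\<phi>((a - b) / 2)\<close>, the square of the bump centred at \<open>(a + b) / 2\<close>. As \<open>\<phi>\<close> has integral one,
  integrating \<open>(|V\<^sub>\<phi> f\<^sub>a| - |V\<^sub>\<phi> f\<^sub>b|)\<^sup>2\<close> gives the squared distance \<open>1 - \<phi>((a - b) / 2)\<close>
  (\<open>L2_norm_gabor_bump_diff\<close>), which is at least \<open>1 - \<phi>(1 / 2) > 0\<close> for distinct integers.
\<close>

section \<open>Separated sequences\<close>

text \<open>A convergent subsequence would be Cauchy, but any two of its terms are at least \<open>\<delta>\<close> apart.\<close>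

lemma (in Metric_space) not_relatively_compact_if_separated:
  fixes s :: "nat \<Rightarrow> 'a"
  assumes s: "range s \<subseteq> M" and \<delta>: "0 < \<delta>" and sep: "\<And>m n. m \<noteq> n \<Longrightarrow> \<delta> \<le> d (s m) (s n)"
  shows "\<not> relatively_compact_in mtopology (range s)"
proof
  assume "relatively_compact_in mtopology (range s)"
  then have "compactin mtopology (mtopology closure_of range s)"
    by (simp add: relatively_compact_in_def)
  moreover have "range s \<subseteq> mtopology closure_of range s"
    using s by (intro closure_of_subset) simp
  ultimately obtain l r where r: "strict_mono (r :: nat \<Rightarrow> nat)"
    and l: "limitin mtopology (s \<circ> r) l sequentially"
    unfolding compactin_sequentially by blast
  have "MCauchy (s \<circ> r)"
    by (rule convergent_imp_MCauchy[OF _ l]) (use s in auto)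
  then obtain N where N: "\<And>n n'. N \<le> n \<Longrightarrow> N \<le> n' \<Longrightarrow> d ((s \<circ> r) n) ((s \<circ> r) n') < \<delta>"
    unfolding MCauchy_def using \<delta> by blast
  have "r N \<noteq> r (Suc N)"
    using strict_monoD[OF r, of N "Suc N"] by simp
  from sep[OF this] N[of N "Suc N"] show False by simp
qed


section \<open>The Gaussian window\<close>

text \<open>The window is a probability density, so its integrals are known from the normal
  distribution.\<close>

lemma gauss_window_shift_eq_normal_density:
  "gauss_window (t - a) = normal_density a (1 / sqrt (2 * pi)) t"
  by (simp add: gauss_window_def normal_density_def power_divide field_simps)

lemma gauss_window_pos [simp]: "0 < gauss_window t"
  by (simp add: gauss_window_def)

lemma gauss_window_le_1: "gauss_window t \<le> 1"
  by (simp add: gauss_window_def)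

lemma borel_measurable_gauss_window [measurable]: "gauss_window \<in> borel_measurable borel"
  unfolding gauss_window_def by measurable

lemma integrable_gauss_window_shift: "integrable lborel (\<lambda>t. gauss_window (t - a))"
  unfolding gauss_window_shift_eq_normal_density by simp

lemma integral_gauss_window_shift: "(LINT t|lborel. gauss_window (t - a)) = 1"
  unfolding gauss_window_shift_eq_normal_density by simp

lemma gauss_window_shift_mult:
  "gauss_window (t - a) * gauss_window (t - b)
    = (gauss_window ((a - b) / 2) * gauss_window (t - (a + b) / 2))\<^sup>2"
proof -
  have "- pi * (t - a)\<^sup>2 + - pi * (t - b)\<^sup>2
      = 2 * (- pi * ((a - b) / 2)\<^sup>2 + - pi * (t - (a + b) / 2)\<^sup>2)"
    by (simp add: power2_eq_square field_simps)
  then show ?thesis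
    unfolding gauss_window_def exp_add[symmetric] exp_double[symmetric] by simp
qed

lemma has_bochner_integral_gauss_window_plane:
  "has_bochner_integral (lborel :: (real \<times> real) measure)
     (\<lambda>(x, y). gauss_window (x - a) * gauss_window y) 1"
proof -
  have [simp]: "integrable lborel gauss_window" "(LINT y|lborel. gauss_window y) = 1"
    using integrable_gauss_window_shift[of 0] integral_gauss_window_shift[of 0] by simp_all
  have int: "integrable (lborel \<Otimes>\<^sub>M lborel) (\<lambda>(x, y). gauss_window (x - a) * gauss_window y)"
    by (rule lborel_pair.Fubini_integrable)
      (auto simp: abs_mult integrable_gauss_window_shift less_imp_le)
  have "(LINT z|(lborel \<Otimes>\<^sub>M lborel). (\<lambda>(x, y). gauss_window (x - a) * gauss_window y) z) = 1"
    using lborel_pair.integral_fst'[OF int] by (simp add: integral_gauss_window_shift)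
  with int show ?thesis
    by (simp add: has_bochner_integral_iff lborel_prod)
qed

lemma integral_std_gauss_iexp:
  "(LINT u|lborel. of_real (exp (- u\<^sup>2 / 2)) * iexp (w * u)) = of_real (sqrt (2 * pi) * exp (- w\<^sup>2 / 2))"
proof -
  have "(LINT u|lborel. of_real (exp (- u\<^sup>2 / 2)) * iexp (w * u))
      = (LINT u|lborel. of_real (sqrt (2 * pi)) * (std_normal_density u *\<^sub>R iexp (w * u)))"
    by (rule Bochner_Integration.integral_cong)
      (simp_all add: std_normal_density_def scaleR_conv_of_real field_simps)
  also have "\<dots> = of_real (sqrt (2 * pi)) * (LINT u|lborel. std_normal_density u *\<^sub>R iexp (w * u))"
    by (rule integral_mult_right_zero)
  also have "(LINT u|lborel. std_normal_density u *\<^sub>R iexp (w * u)) = char std_normal_distribution w"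
    unfolding char_def by (subst integral_density) auto
  finally show ?thesis
    by (simp add: char_std_normal_distribution)
qed


section \<open>Gabor transforms of shifted windows\<close>

definition shifted_window :: "real \<Rightarrow> real \<Rightarrow> complex" where
  "shifted_window a t = of_real (gauss_window (t - a))"

text \<open>The product of the shifted window with the analysing window is a Gaussian centred at the
  midpoint \<open>(a + x) / 2\<close>. Recentring there costs a phase, which the modulus removes; what is left
  is the Fourier transform of a centred Gaussian.\<close>

lemma norm_gabor_shifted_window:
  "norm (gabor (shifted_window a) (x, y)) = sqrt (gauss_window (x - a) * gauss_window y / 2)"
proof -
  \<comment> \<open>The substitution \<open>t = (a + x) / 2 + c u\<close> turns \<open>exp (- 2 pi (t - (a + x) / 2)\<^sup>2)\<close> into \<open>exp (- u\<^sup>2 / 2)\<close>.\<close>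
  define c where "c = 1 / (2 * sqrt pi)"
  have c: "0 < c" "pi * (2 * c)\<^sup>2 = 1"
    by (simp_all add: c_def power_divide power_mult_distrib)
  define w where "w = - 2 * pi * c * y"
  define K where "K = of_real ((gauss_window ((a - x) / 2))\<^sup>2) * iexp (- (pi * (a + x) * y))"
  have integrand: "of_real (gauss_window ((a + x) / 2 + c * u - a)) * of_real (gauss_window ((a + x) / 2 + c * u - x))
      * exp (- 2 * of_real pi * \<i> * of_real ((a + x) / 2 + c * u) * of_real y)
      = K * (of_real (exp (- u\<^sup>2 / 2)) * iexp (w * u))" for u
  proof -
    have "(gauss_window (c * u))\<^sup>2 = exp (2 * (- pi * (c * u)\<^sup>2))"
      unfolding gauss_window_def by (rule exp_double[symmetric])
    also have "2 * (- pi * (c * u)\<^sup>2) = - (pi * (2 * c)\<^sup>2) * u\<^sup>2 / 2"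
      by (simp add: power_mult_distrib)
    finally have "(gauss_window (c * u))\<^sup>2 = exp (- u\<^sup>2 / 2)"
      using c(2) by simp
    then have mod: "gauss_window ((a + x) / 2 + c * u - a) * gauss_window ((a + x) / 2 + c * u - x)
        = (gauss_window ((a - x) / 2))\<^sup>2 * exp (- u\<^sup>2 / 2)"
      unfolding gauss_window_shift_mult by (simp add: power_mult_distrib)
    have "exp (- 2 * of_real pi * \<i> * of_real ((a + x) / 2 + c * u) * of_real y)
        = iexp (- (pi * (a + x) * y) + w * u)"
      by (rule arg_cong[where f = exp]) (simp add: w_def field_simps)
    also have "\<dots> = iexp (- (pi * (a + x) * y)) * iexp (w * u)"
      unfolding exp_add[symmetric] by (rule arg_cong[where f = exp]) (simp add: algebra_simps)
    finally show ?thesis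
      unfolding of_real_mult[symmetric] mod by (simp add: K_def)
  qed
  have "gabor (shifted_window a) (x, y)
      = \<bar>c\<bar> *\<^sub>R (LINT u|lborel. K * (of_real (exp (- u\<^sup>2 / 2)) * iexp (w * u)))"
    unfolding gabor_def case_prod_conv shifted_window_def integrand[symmetric]
    by (rule lborel_integral_real_affine) (use c(1) in simp)
  also have "\<dots> = of_real c * (K * of_real (sqrt (2 * pi) * exp (- w\<^sup>2 / 2)))"
    unfolding integral_mult_right_zero integral_std_gauss_iexp
    using c(1) by (simp add: scaleR_conv_of_real)
  finally have "norm (gabor (shifted_window a) (x, y))
      = c * ((gauss_window ((a - x) / 2))\<^sup>2 * (sqrt (2 * pi) * exp (- w\<^sup>2 / 2)))"
    using c(1) by (simp add: K_def norm_mult norm_power)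
  also have "\<dots> = sqrt (gauss_window (x - a) * gauss_window y / 2)"
  proof (rule real_sqrt_unique[symmetric])
    have "((gauss_window ((a - x) / 2))\<^sup>2)\<^sup>2 = gauss_window (x - a)"
      by (simp add: gauss_window_def exp_double[symmetric] power_divide power2_commute)
    moreover have "(exp (- w\<^sup>2 / 2))\<^sup>2 = gauss_window y"
    proof -
      have "w\<^sup>2 = pi * (pi * (2 * c)\<^sup>2) * y\<^sup>2"
        by (simp add: w_def power_mult_distrib power2_eq_square)
      then have "w\<^sup>2 = pi * y\<^sup>2"
        unfolding c(2) by simp
      then show ?thesis
        by (simp add: gauss_window_def exp_double[symmetric])
    qed
    moreover have "c\<^sup>2 * (sqrt (2 * pi))\<^sup>2 = 1 / 2"
      by (simp add: c_def power_divide power_mult_distrib)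
    ultimately show "(c * ((gauss_window ((a - x) / 2))\<^sup>2 * (sqrt (2 * pi) * exp (- w\<^sup>2 / 2))))\<^sup>2
        = gauss_window (x - a) * gauss_window y / 2"
      unfolding power_mult_distrib by (simp add: mult_ac)
  qed (use c(1) in simp)
  finally show ?thesis .
qed

definition gabor_bump :: "real \<Rightarrow> real \<times> real \<Rightarrow> real" where
  "gabor_bump a = (\<lambda>(x, y). sqrt (gauss_window (x - a) * gauss_window y / 2))"

lemma norm_gabor_eq_gabor_bump:
  "(\<lambda>z. norm (gabor (shifted_window a) z)) = gabor_bump a"
  by (auto simp: gabor_bump_def norm_gabor_shifted_window)

lemma gabor_bump_nonneg: "0 \<le> gabor_bump a z"
  by (simp add: gabor_bump_def less_imp_le split: prod.split)

lemma gabor_bump_mult: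
  "gabor_bump a (x, y) * gabor_bump b (x, y)
    = gauss_window ((a - b) / 2) * (gauss_window (x - (a + b) / 2) * gauss_window y) / 2"
proof -
  have "gabor_bump a (x, y) * gabor_bump b (x, y)
      = sqrt ((gauss_window (x - a) * gauss_window (x - b)) * (gauss_window y / 2)\<^sup>2)"
    by (simp add: gabor_bump_def real_sqrt_mult[symmetric] power2_eq_square mult_ac)
  also have "\<dots> = sqrt ((gauss_window ((a - b) / 2) * gauss_window (x - (a + b) / 2) * (gauss_window y / 2))\<^sup>2)"
    unfolding gauss_window_shift_mult power_mult_distrib ..
  also have "\<dots> = gauss_window ((a - b) / 2) * gauss_window (x - (a + b) / 2) * (gauss_window y / 2)"
    by (simp add: less_imp_le)
  finally show ?thesis by simp
qed

lemma has_bochner_integral_gabor_bump_mult: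
  "has_bochner_integral lborel (\<lambda>z. gabor_bump a z * gabor_bump b z) (gauss_window ((a - b) / 2) / 2)"
proof -
  have "(\<lambda>z. gabor_bump a z * gabor_bump b z) = (\<lambda>z. gauss_window ((a - b) / 2) / 2
      * (\<lambda>(x, y). gauss_window (x - (a + b) / 2) * gauss_window y) z)"
    by (auto simp: fun_eq_iff gabor_bump_mult)
  then show ?thesis
    using has_bochner_integral_mult_right[OF has_bochner_integral_gauss_window_plane[of "(a + b) / 2"],
        of "gauss_window ((a - b) / 2) / 2"]
    by simp
qed

lemma gabor_bump_square_integrable: "gabor_bump a \<in> square_integrable lborel"
proof -
  have "gabor_bump a \<in> borel_measurable (borel \<Otimes>\<^sub>M borel)"
    unfolding gabor_bump_def by measurable
  then show ?thesis
    using has_bochner_integral_gabor_bump_mult[of a a]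
    by (simp add: square_integrable_def power2_eq_square has_bochner_integral_iff borel_prod)
qed

lemma L2_norm_gabor_bump_diff:
  "L2_norm lborel (\<lambda>z. gabor_bump a z - gabor_bump b z) = sqrt (1 - gauss_window ((a - b) / 2))"
proof -
  have "has_bochner_integral lborel
      (\<lambda>z. gabor_bump a z * gabor_bump a z + gabor_bump b z * gabor_bump b z
         - 2 * (gabor_bump a z * gabor_bump b z))
      (gauss_window ((a - a) / 2) / 2 + gauss_window ((b - b) / 2) / 2
         - 2 * (gauss_window ((a - b) / 2) / 2))"
    by (intro has_bochner_integral_diff has_bochner_integral_add has_bochner_integral_mult_right
        has_bochner_integral_gabor_bump_mult)
  then have "has_bochner_integral lborel (\<lambda>z. (norm (gabor_bump a z - gabor_bump b z))\<^sup>2)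
      (1 - gauss_window ((a - b) / 2))"
    by (simp add: power2_eq_square algebra_simps) (simp add: gauss_window_def)
  then show ?thesis
    by (simp add: L2_norm_def has_bochner_integral_integral_eq)
qed


section \<open>Failure of compactness\<close>

text \<open>The bound one is not sharp, but it comes for free from \<open>\<phi>\<^sup>2 \<le> \<phi>\<close>.\<close>

lemma
  shows shifted_window_square_integrable: "shifted_window a \<in> square_integrable lborel"
    and L2_norm_shifted_window_le_1: "L2_norm lborel (shifted_window a) \<le> 1"
proof -
  have sq: "(norm (shifted_window a t))\<^sup>2 \<le> gauss_window (t - a)" for t
    using mult_left_mono[OF gauss_window_le_1[of "t - a"], of "gauss_window (t - a)"]
    by (simp add: shifted_window_def power2_eq_square less_imp_le)
  have [measurable]: "shifted_window a \<in> borel_measurable borel"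
    unfolding shifted_window_def by measurable
  have int: "integrable lborel (\<lambda>t. (norm (shifted_window a t))\<^sup>2)"
    by (rule Bochner_Integration.integrable_bound[OF integrable_gauss_window_shift[of a]])
      (use sq in \<open>auto simp: less_imp_le\<close>)
  then show "shifted_window a \<in> square_integrable lborel"
    by (simp add: square_integrable_def)
  have "(LINT t|lborel. (norm (shifted_window a t))\<^sup>2) \<le> (LINT t|lborel. gauss_window (t - a))"
    by (rule integral_mono[OF int integrable_gauss_window_shift sq])
  then show "L2_norm lborel (shifted_window a) \<le> 1"
    by (simp add: L2_norm_def integral_gauss_window_shift)
qed

lemma phase_dist_class_le:
  assumes "f \<in> square_integrable lborel" "g \<in> square_integrable lborel"
  shows "phase_dist (phase_rel lborel `` {f}) (phase_rel lborel `` {g})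
    \<le> L2_norm lborel f + L2_norm lborel g"
proof -
  \<comment> \<open>The phase \<open>- 1\<close> makes the difference a sum, to which the triangle inequality applies directly.\<close>
  have "phase_dist (phase_rel lborel `` {f}) (phase_rel lborel `` {g})
      \<le> L2_norm lborel (\<lambda>t. f t - (- 1) * g t)"
    unfolding phase_dist_class[OF assms] by (rule cINF_lower[OF bdd_below_L2_norm]) simp
  also have "\<dots> \<le> L2_norm lborel f + L2_norm lborel g"
    using L2_norm_triangle[OF assms] by simp
  finally show ?thesis .
qed

theorem proposition2p2:
  shows "\<not> compact_operator L2_mod_phase L2_nonneg gabor_magnitude"
proof
  assume compact: "compact_operator L2_mod_phase L2_nonneg gabor_magnitude"
  define F where "F n = phase_rel lborel `` {shifted_window (real n)}" for n :: nat
  define G where "G n = ae_rel lborel `` {gabor_bump (real n)}" for n :: nat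
  have image: "gabor_magnitude ` range F = range G"
  proof -
    have "gabor_magnitude (F n) = G n" for n
      by (simp add: F_def G_def gabor_magnitude_class[OF shifted_window_square_integrable]
          norm_gabor_eq_gabor_bump)
    then show ?thesis by (simp add: image_image)
  qed
  have "Metric_space.mbounded (mspace L2_mod_phase) (mdist L2_mod_phase) (range F)"
    unfolding mspace_L2_mod_phase mdist_L2_mod_phase
      Metric_space.mbounded_alt[OF Metric_space_L2_mod_phase]
  proof (intro conjI exI ballI)
    show "range F \<subseteq> square_integrable lborel // phase_rel lborel"
      by (auto simp: F_def intro: quotientI shifted_window_square_integrable)
    fix P Q assume "P \<in> range F" "Q \<in> range F"
    then obtain m n where "P = F m" "Q = F n" by blast
    then show "phase_dist P Q \<le> 2"
      using phase_dist_class_le[OF shifted_window_square_integrable shifted_window_square_integrable,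
          of "real m" "real n"]
        L2_norm_shifted_window_le_1[of "real m"] L2_norm_shifted_window_le_1[of "real n"]
      by (simp add: F_def)
  qed
  with compact have "relatively_compact_in (mtopology_of L2_nonneg) (range G)"
    unfolding compact_operator_def image[symmetric] by blast
  moreover have "\<not> relatively_compact_in (mtopology_of L2_nonneg) (range G)"
    unfolding mtopology_of_def mspace_L2_nonneg mdist_L2_nonneg
  proof (rule Metric_space.not_relatively_compact_if_separated[OF Metric_space_L2_nonneg])
    show "range G \<subseteq> {f \<in> square_integrable lborel. \<forall>z. 0 \<le> f z} // ae_rel lborel"
      by (auto simp: G_def intro!: quotientI gabor_bump_square_integrable gabor_bump_nonneg)
    show "0 < sqrt (1 - gauss_window (1 / 2))"
      by (simp add: gauss_window_def)
    fix m n :: nat assume "m \<noteq> n"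
    then have "1 \<le> \<bar>real m - real n\<bar>" by linarith
    then have "(1 / 2)\<^sup>2 \<le> ((real m - real n) / 2)\<^sup>2"
      unfolding abs_le_square_iff[symmetric] by simp
    then have "gauss_window ((real m - real n) / 2) \<le> gauss_window (1 / 2)"
      unfolding gauss_window_def by simp
    then show "sqrt (1 - gauss_window (1 / 2)) \<le> L2_dist (G m) (G n)"
      unfolding G_def L2_dist_class[OF gabor_bump_square_integrable gabor_bump_square_integrable]
        L2_norm_gabor_bump_diff by simp
  qed
  ultimately show False by blast
qed

end
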